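(* For any $(a,b),(p_1,q_1),(p_2,q_2)\in\mathbb{R}_+^2$ and $\alpha,\beta>0$ with $\alpha+\beta=1$, the following double inequality holds: $$1\le \frac{G_{\alpha p_1+\beta p_2,\ \alpha q_1+\beta q_2}(a,b)}{G_{p_1,q_1}(a,b)^{\alpha}\,G_{p_2,q_2}(a,b)^{\beta}}\le \exp\left(\frac{\alpha}{L(p_1,q_1)}+\frac{\beta}{L(p_2,q_2)}-\frac{1}{L(\alpha p_1+\beta p_2,\ \alpha q_1+\beta q_2)}\right).$$
   Context: Notation: $\mathbb{R}_+=(0,\infty)$. $L$ is the logarithmic mean: $L(x,y)=\frac{x-y}{\ln x-\ln y}$ for $x,y>0$, $x\ne y$, and $L(x,x)=x$. Gini means: for $a,b>0$, $G_{p,q}(a,b)=\left(\frac{a^p+b^p}{a^q+b^q}\right)^{1/(p-q)}$ if $p\neq q$, and $G_{p,p}(a,b)=\exp\left(\frac{a^p\ln a+b^p\ln b}{a^p+b^p}\right)$. *)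

theory Defs
  imports Complex_Main
begin

definition log_mean :: "real \<Rightarrow> real \<Rightarrow> real" where
  "log_mean x y = (if x = y then x else (x - y) / (ln x - ln y))"

definition gini_mean :: "real \<Rightarrow> real \<Rightarrow> real \<Rightarrow> real \<Rightarrow> real" where
  "gini_mean p q a b =
     (if p \<noteq> q
      then ((a powr p + b powr p) / (a powr q + b powr q)) powr (1 / (p - q))
      else exp ((a powr p * ln a + b powr p * ln b) / (a powr p + b powr p)))"

end

(* The logarithm of G_{p,q} is the average of the derivative s \<mapsto> (A ln a + B ln b) / (A + B) of
   s \<mapsto> ln (A + B), with A = a^s and B = b^s, over the segment between p and q, while 1 / L(p, q)
   is the average of 1 / s. Averaging over segments preserves convexity, so it suffices that this
   derivative is concave, and becomes convex after adding 1 / s. Its second derivative is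
   (ln a - ln b)^3 A B (B - A) / (A + B)^3, which is nonpositive and at least -2 / s^3. *)
theory Submission
  imports Defs "HOL-Analysis.Convex"
begin

text \<open>With \<open>F\<close> a primitive of \<open>f\<close>, this is the average of
  \<open>f\<close> over the segment between \<open>p\<close> and \<open>q\<close>. The value at
  \<open>p = q\<close> is the limit of the divided difference.\<close>

definition segment_mean :: "(real \<Rightarrow> real) \<Rightarrow> (real \<Rightarrow> real) \<Rightarrow> real \<Rightarrow> real \<Rightarrow> real" where
  "segment_mean F f p q = (if p = q then f p else (F p - F q) / (p - q))"

(* A primitive of t \<mapsto> f (q + t (p - q)), which avoids integrals. *)
definition segment_primitive ::
  "(real \<Rightarrow> real) \<Rightarrow> (real \<Rightarrow> real) \<Rightarrow> real \<Rightarrow> real \<Rightarrow> real \<Rightarrow> real" where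
  "segment_primitive F f p q t = (if p = q then t * f p else F (q + t * (p - q)) / (p - q))"

lemma segment_primitive_diff:
  "segment_primitive F f p q 1 - segment_primitive F f p q 0 = segment_mean F f p q"
  by (simp add: segment_primitive_def segment_mean_def diff_divide_distrib)

lemma DERIV_segment_primitive:
  assumes "(F has_real_derivative f (q + t * (p - q))) (at (q + t * (p - q)))"
  shows "(segment_primitive F f p q has_real_derivative f (q + t * (p - q))) (at t)"
proof (cases "p = q")
  case True
  have eq: "segment_primitive F f p q = (\<lambda>t. t * f p)"
    using True by (auto simp: segment_primitive_def)
  show ?thesis
    unfolding eq using True by (auto intro!: derivative_eq_intros)
next
  case False
  have eq: "segment_primitive F f p q = (\<lambda>t. F (q + t * (p - q)) / (p - q))"
    using False by (auto simp: segment_primitive_def)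
  have "((\<lambda>t. q + t * (p - q)) has_real_derivative (p - q)) (at t)"
    by (auto intro!: derivative_eq_intros)
  then have "((\<lambda>t. F (q + t * (p - q))) has_real_derivative f (q + t * (p - q)) * (p - q)) (at t)"
    using assms by (rule DERIV_chain2[rotated])
  then show ?thesis
    unfolding eq using False by (auto dest: DERIV_cdivide[where c = "p - q"])
qed

text \<open>The point with parameter \<open>t\<close> on the combined segment is the same convex
  combination of the points with parameter \<open>t\<close> on the two given segments. Hence the
  inequality for averages is the inequality for values of \<open>f\<close>, integrated over
  \<open>t\<close> from 0 to 1.\<close>

lemma segment_mean_convex:
  assumes deriv: "\<And>s. s \<in> I \<Longrightarrow> (F has_real_derivative f s) (at s)"
    and conv: "convex_on I f"
    and mem: "p1 \<in> I" "q1 \<in> I" "p2 \<in> I" "q2 \<in> I"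
    and uv: "0 \<le> u" "0 \<le> v" "u + v = 1"
  shows "segment_mean F f (u * p1 + v * p2) (u * q1 + v * q2)
    \<le> u * segment_mean F f p1 q1 + v * segment_mean F f p2 q2"
proof -
  define p q where "p = u * p1 + v * p2" and "q = u * q1 + v * q2"
  define K where "K t = u * segment_primitive F f p1 q1 t + v * segment_primitive F f p2 q2 t
    - segment_primitive F f p q t" for t
  have cI: "convex I"
    using conv by (simp add: convex_on_def)
  have pq: "p \<in> I" "q \<in> I"
    unfolding p_def q_def using convexD[OF cI _ _ uv] mem by auto
  have seg: "y + t * (x - y) \<in> I" if "x \<in> I" "y \<in> I" "0 \<le> t" "t \<le> 1" for x y t
    using convexD[OF cI that(1,2), of t "1 - t"] that by (simp add: algebra_simps)
  \<comment> \<open>\<open>K 1 - K 0\<close> is the right side of the claim minus the left side, and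
    the derivative of \<open>K\<close> at \<open>t\<close> is the convexity gap of \<open>f\<close>
    at parameter \<open>t\<close>.\<close>
  have "K 0 \<le> K 1"
  proof (rule DERIV_nonneg_imp_nondecreasing[where f = K])
    fix t :: real
    assume t: "0 \<le> t" "t \<le> 1"
    let ?x1 = "q1 + t * (p1 - q1)" and ?x2 = "q2 + t * (p2 - q2)" and ?x = "q + t * (p - q)"
    have in1: "?x1 \<in> I" and in2: "?x2 \<in> I" and in3: "?x \<in> I"
      using seg mem pq t by blast+
    have "(K has_real_derivative (u * f ?x1 + v * f ?x2 - f ?x)) (at t)"
      unfolding K_def
      by (intro DERIV_diff DERIV_add DERIV_cmult DERIV_segment_primitive deriv in1 in2 in3)
    moreover have "f ?x \<le> u * f ?x1 + v * f ?x2"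
    proof -
      have "?x = u *\<^sub>R ?x1 + v *\<^sub>R ?x2"
        by (simp add: p_def q_def algebra_simps)
      then show ?thesis
        using conv in1 in2 uv unfolding convex_on_def by metis
    qed
    ultimately show "\<exists>y. (K has_real_derivative y) (at t) \<and> 0 \<le> y"
      by (metis diff_ge_0_iff_ge)
  qed simp
  moreover have "K 1 - K 0 = u * (segment_primitive F f p1 q1 1 - segment_primitive F f p1 q1 0)
      + v * (segment_primitive F f p2 q2 1 - segment_primitive F f p2 q2 0)
      - (segment_primitive F f p q 1 - segment_primitive F f p q 0)"
    by (simp add: K_def algebra_simps)
  ultimately show ?thesis
    by (simp add: segment_primitive_diff p_def q_def)
qed

text \<open>This is the analytic core of the upper bound: for \<open>w = s * (x - y)\<close>, the
  square on the right equals \<open>(A + B)^2 / (A * B)\<close> with \<open>A = exp (s * x)\<close>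
  and \<open>B = exp (s * y)\<close>.\<close>

lemma cube_le_exp_sum:
  fixes w :: real
  shows "\<bar>w\<bar> ^ 3 \<le> 2 * (exp (w / 2) + exp (- w / 2))\<^sup>2"
proof -
  \<comment> \<open>Stopping at degree 3 leaves a remainder of even order, so the bound also holds
    for negative \<open>v\<close>.\<close>
  have cubic: "1 + v + v\<^sup>2 / 2 + v ^ 3 / 6 \<le> exp v" for v :: real
  proof -
    obtain t where "exp v = (\<Sum>m<4. v ^ m / fact m) + exp t / fact 4 * v ^ 4"
      using Maclaurin_exp_le[of v 4] by blast
    moreover have "0 \<le> exp t / fact 4 * v ^ 4"
      by simp
    ultimately show ?thesis
      by (simp add: eval_nat_numeral)
  qed
  \<comment> \<open>The odd terms at \<open>w / 2\<close> and \<open>- w / 2\<close> cancel.\<close>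
  have "2 + w\<^sup>2 / 4 \<le> exp (w / 2) + exp (- w / 2)"
    using cubic[of "w / 2"] cubic[of "- w / 2"] by (simp add: power_divide field_simps)
  then have "(2 + w\<^sup>2 / 4)\<^sup>2 \<le> (exp (w / 2) + exp (- w / 2))\<^sup>2"
    by (intro power_mono) auto
  moreover have "u ^ 3 \<le> 2 * (2 + u\<^sup>2 / 4)\<^sup>2" for u :: real
  proof -
    have "2 * (2 + u\<^sup>2 / 4)\<^sup>2 - u ^ 3 = (u\<^sup>2 - 4 * u)\<^sup>2 / 8 + 8"
      by (simp add: power2_eq_square power3_eq_cube field_simps)
    then show ?thesis
      using zero_le_power2[of "u\<^sup>2 - 4 * u"] by linarith
  qed
  from this[of "\<bar>w\<bar>"] have "\<bar>w\<bar> ^ 3 \<le> 2 * (2 + w\<^sup>2 / 4)\<^sup>2"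
    by simp
  ultimately show ?thesis
    by linarith
qed

text \<open>With \<open>x = ln a\<close> and \<open>y = ln b\<close> this is the logarithm of
  \<open>a powr s + b powr s\<close>; exponentials make \<open>s\<close> the only variable to
  differentiate in.\<close>

definition log_sum :: "real \<Rightarrow> real \<Rightarrow> real \<Rightarrow> real" where
  "log_sum x y s = ln (exp (s * x) + exp (s * y))"

definition log_sum' :: "real \<Rightarrow> real \<Rightarrow> real \<Rightarrow> real" where
  "log_sum' x y s = (exp (s * x) * x + exp (s * y) * y) / (exp (s * x) + exp (s * y))"

definition log_sum'' :: "real \<Rightarrow> real \<Rightarrow> real \<Rightarrow> real" where
  "log_sum'' x y s = (x - y)\<^sup>2 * (exp (s * x) * exp (s * y)) / (exp (s * x) + exp (s * y))\<^sup>2"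

definition log_sum''' :: "real \<Rightarrow> real \<Rightarrow> real \<Rightarrow> real" where
  "log_sum''' x y s = (x - y) ^ 3 * (exp (s * x) * exp (s * y)) * (exp (s * y) - exp (s * x))
    / (exp (s * x) + exp (s * y)) ^ 3"

lemma exp_add_exp_neq_0: "exp x + exp y \<noteq> (0 :: real)"
  using exp_gt_zero[of x] exp_gt_zero[of y] by linarith

lemma DERIV_log_sum: "(log_sum x y has_real_derivative log_sum' x y s) (at s)"
  unfolding log_sum_def[abs_def] log_sum'_def
  by (auto intro!: derivative_eq_intros add_pos_pos simp: exp_add_exp_neq_0 divide_inverse algebra_simps)

lemma DERIV_log_sum': "(log_sum' x y has_real_derivative log_sum'' x y s) (at s)"
  unfolding log_sum'_def[abs_def] log_sum''_def
  by (auto intro!: derivative_eq_intros simp: exp_add_exp_neq_0 power2_eq_square)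
     (simp add: algebra_simps)

lemma DERIV_log_sum'': "(log_sum'' x y has_real_derivative log_sum''' x y s) (at s)"
proof -
  define A B where "A = exp (s * x)" and "B = exp (s * y)"
  have nz: "A + B \<noteq> 0"
    unfolding A_def B_def by (rule exp_add_exp_neq_0)
  have "(log_sum'' x y has_real_derivative
      ((x - y)\<^sup>2 * (A * x * B + A * (B * y)) * (A + B)\<^sup>2
        - (x - y)\<^sup>2 * (A * B) * (2 * (A + B) * (A * x + B * y))) / ((A + B)\<^sup>2 * (A + B)\<^sup>2)) (at s)"
    unfolding log_sum''_def[abs_def] A_def B_def
    by (auto intro!: derivative_eq_intros simp: exp_add_exp_neq_0 algebra_simps)
  \<comment> \<open>One factor \<open>A + B\<close> splits off the numerator, and the third factor
    \<open>x - y\<close> comes from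
    \<open>(x + y) * (A + B) - 2 * (A * x + B * y) = (x - y) * (B - A)\<close>.\<close>
  also have "((x - y)\<^sup>2 * (A * x * B + A * (B * y)) * (A + B)\<^sup>2
        - (x - y)\<^sup>2 * (A * B) * (2 * (A + B) * (A * x + B * y))) / ((A + B)\<^sup>2 * (A + B)\<^sup>2)
      = (A + B) * ((x - y) ^ 3 * (A * B) * (B - A)) / ((A + B) * (A + B) ^ 3)"
    by (rule arg_cong2[where f = "(/)"]) (simp_all add: power2_eq_square power3_eq_cube algebra_simps)
  also have "\<dots> = log_sum''' x y s"
    using nz by (simp add: log_sum'''_def A_def B_def)
  finally show ?thesis .
qed

text \<open>For \<open>s\<close> nonnegative, \<open>exp (s * x)\<close> is nondecreasing in
  \<open>x\<close>, so \<open>x - y\<close> and \<open>B - A\<close> never have the same strict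
  sign; the remaining factors are nonnegative.\<close>

lemma log_sum'''_nonpos:
  assumes "0 \<le> s"
  shows "log_sum''' x y s \<le> 0"
proof -
  have "(x - y) * (exp (s * y) - exp (s * x)) \<le> 0"
    using assms by (cases "x \<le> y") (auto simp: mult_le_0_iff intro: mult_left_mono)
  then have "(x - y)\<^sup>2 * (exp (s * x) * exp (s * y)) * ((x - y) * (exp (s * y) - exp (s * x))) \<le> 0"
    by (rule mult_nonneg_nonpos[rotated]) simp
  also have "(x - y)\<^sup>2 * (exp (s * x) * exp (s * y)) * ((x - y) * (exp (s * y) - exp (s * x)))
      = (x - y) ^ 3 * (exp (s * x) * exp (s * y)) * (exp (s * y) - exp (s * x))"
    by (simp add: power2_eq_square power3_eq_cube)
  finally show ?thesis
    unfolding log_sum'''_def by (intro divide_nonpos_nonneg) (auto simp: add_nonneg_nonneg)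
qed

text \<open>The absolute value is bounded by \<open>2 / s ^ 3\<close>:
  \<open>cube_le_exp_sum\<close> controls the cube of \<open>w = s * (x - y)\<close>, and
  \<open>B - A\<close> is at most \<open>A + B\<close> in absolute value.\<close>

lemma log_sum'''_ge:
  assumes "0 < s"
  shows "- 2 / s ^ 3 \<le> log_sum''' x y s"
proof -
  define A B where "A = exp (s * x)" and "B = exp (s * y)"
  have pos: "0 < A" "0 < B"
    by (simp_all add: A_def B_def)
  define w where "w = s * (x - y)"
  have "A * B * (exp (w / 2) + exp (- w / 2))\<^sup>2 = (A + B)\<^sup>2"
  proof -
    \<comment> \<open>\<open>m\<close> is the geometric mean of \<open>A\<close> and
      \<open>B\<close>; factoring it out leaves the symmetric exponentials of
      \<open>cube_le_exp_sum\<close>.\<close>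
    define m where "m = exp (s * (x + y) / 2)"
    have "A = m * exp (w / 2)" "B = m * exp (- w / 2)"
      by (simp_all add: A_def B_def m_def w_def exp_add[symmetric] field_simps)
    moreover have "exp (w / 2) * exp (- w / 2) = 1"
      by (simp add: exp_add[symmetric])
    ultimately show ?thesis
      by (simp add: power2_eq_square algebra_simps)
  qed
  then have "A * B * \<bar>w\<bar> ^ 3 \<le> 2 * (A + B)\<^sup>2"
    using mult_left_mono[OF cube_le_exp_sum[of w], of "A * B"] pos
    by (metis less_imp_le mult_pos_pos mult.left_commute)
  then have "(A * B * \<bar>w\<bar> ^ 3) * \<bar>B - A\<bar> \<le> (2 * (A + B)\<^sup>2) * (A + B)"
    by (rule mult_mono) (use pos in auto)
  also have "(A * B * \<bar>w\<bar> ^ 3) * \<bar>B - A\<bar> = s ^ 3 * \<bar>(x - y) ^ 3 * (A * B) * (B - A)\<bar>"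
    using pos assms by (simp add: w_def abs_mult power_abs power_mult_distrib)
  also have "(2 * (A + B)\<^sup>2) * (A + B) = 2 * (A + B) ^ 3"
    by (simp add: power2_eq_square power3_eq_cube)
  finally have "s ^ 3 * \<bar>(x - y) ^ 3 * (A * B) * (B - A)\<bar> \<le> 2 * (A + B) ^ 3" .
  then have "s ^ 3 * \<bar>log_sum''' x y s\<bar> \<le> 2"
    using pos unfolding log_sum'''_def A_def[symmetric] B_def[symmetric] abs_divide
    by (simp only: times_divide_eq_right) (simp add: divide_le_eq)
  then have "\<bar>log_sum''' x y s\<bar> \<le> 2 / s ^ 3"
    using assms by (simp add: field_simps)
  then show ?thesis
    by simp
qed

lemma concave_log_sum': "convex_on {0<..} (\<lambda>s. - log_sum' x y s)"
  by (rule f''_ge0_imp_convex[where f' = "\<lambda>s. - log_sum'' x y s" and f'' = "\<lambda>s. - log_sum''' x y s"])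
     (auto intro!: DERIV_minus DERIV_log_sum' DERIV_log_sum'' log_sum'''_nonpos)

text \<open>The second derivative of \<open>1 / s\<close> is \<open>2 / s ^ 3\<close>, which exactly
  offsets the lower bound in \<open>log_sum'''_ge\<close>.\<close>

lemma convex_log_sum'_add_inverse: "convex_on {0<..} (\<lambda>s. log_sum' x y s + 1 / s)"
proof (rule f''_ge0_imp_convex)
  fix s :: real
  assume s: "s \<in> {0<..}"
  have "((\<lambda>s. 1 / s) has_real_derivative - 1 / s\<^sup>2) (at s)"
    using s by (auto intro!: derivative_eq_intros simp: power2_eq_square)
  then show "((\<lambda>s. log_sum' x y s + 1 / s) has_real_derivative log_sum'' x y s + - 1 / s\<^sup>2) (at s)"
    by (intro DERIV_add DERIV_log_sum')
  have "((\<lambda>s. - 1 / s\<^sup>2) has_real_derivative 2 / s ^ 3) (at s)"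
    using s by (auto intro!: derivative_eq_intros simp: power2_eq_square power3_eq_cube)
  then show "((\<lambda>s. log_sum'' x y s + - 1 / s\<^sup>2) has_real_derivative log_sum''' x y s + 2 / s ^ 3) (at s)"
    by (intro DERIV_add DERIV_log_sum'')
  show "0 \<le> log_sum''' x y s + 2 / s ^ 3"
    using log_sum'''_ge[of s x y] s by simp
qed simp

lemma gini_mean_pos:
  assumes "a > 0" "b > 0"
  shows "gini_mean p q a b > 0"
proof -
  have "a powr p + b powr p > 0" "a powr q + b powr q > 0"
    using assms by (simp_all add: add_pos_pos)
  then show ?thesis
    by (simp add: gini_mean_def)
qed

text \<open>The logarithm turns the exponent \<open>1 / (p - q)\<close> into the denominator of a
  divided difference; for \<open>p = q\<close> the exponent in the definition is already the
  derivative of \<open>log_sum\<close>.\<close>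

lemma ln_gini_mean:
  assumes "a > 0" "b > 0"
  shows "ln (gini_mean p q a b)
    = segment_mean (log_sum (ln a) (ln b)) (log_sum' (ln a) (ln b)) p q"
proof -
  have pos: "a powr r + b powr r > 0" for r
    using assms by (simp add: add_pos_pos)
  have "ln (a powr r + b powr r) = log_sum (ln a) (ln b) r" for r
    using assms by (simp add: log_sum_def powr_def)
  moreover have "(a powr r * ln a + b powr r * ln b) / (a powr r + b powr r)
      = log_sum' (ln a) (ln b) r" for r
    using assms by (simp add: log_sum'_def powr_def)
  ultimately show ?thesis
    using pos[of p] pos[of q]
    by (simp add: gini_mean_def segment_mean_def ln_powr ln_div divide_simps)
qed

lemma inverse_log_mean:
  "1 / log_mean p q = segment_mean ln (\<lambda>s. 1 / s) p q"
  by (simp add: log_mean_def segment_mean_def)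

lemma segment_mean_minus:
  "segment_mean (\<lambda>s. - F s) (\<lambda>s. - f s) p q = - segment_mean F f p q"
  by (simp add: segment_mean_def field_simps)

lemma segment_mean_add:
  "segment_mean (\<lambda>s. F s + G s) (\<lambda>s. f s + g s) p q = segment_mean F f p q + segment_mean G g p q"
  by (simp add: segment_mean_def add_divide_distrib[symmetric])

theorem corollary4p2:
  fixes a b p1 q1 p2 q2 \<alpha> \<beta> :: real
  assumes "a > 0" "b > 0" "p1 > 0" "q1 > 0" "p2 > 0" "q2 > 0"
    and "\<alpha> > 0" "\<beta> > 0" "\<alpha> + \<beta> = 1"
  shows "1 \<le> gini_mean (\<alpha> * p1 + \<beta> * p2) (\<alpha> * q1 + \<beta> * q2) a b
              / (gini_mean p1 q1 a b powr \<alpha> * gini_mean p2 q2 a b powr \<beta>)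
       \<and> gini_mean (\<alpha> * p1 + \<beta> * p2) (\<alpha> * q1 + \<beta> * q2) a b
              / (gini_mean p1 q1 a b powr \<alpha> * gini_mean p2 q2 a b powr \<beta>)
         \<le> exp (\<alpha> / log_mean p1 q1 + \<beta> / log_mean p2 q2
                 - 1 / log_mean (\<alpha> * p1 + \<beta> * p2) (\<alpha> * q1 + \<beta> * q2))"
proof -
  define G where "G p q = ln (gini_mean p q a b)" for p q
  define N where "N p q = 1 / log_mean p q" for p q
  define p q where "p = \<alpha> * p1 + \<beta> * p2" and "q = \<alpha> * q1 + \<beta> * q2"
  let ?F = "log_sum (ln a) (ln b)" and ?f = "log_sum' (ln a) (ln b)"
  have mem: "p1 \<in> {0<..}" "q1 \<in> {0<..}" "p2 \<in> {0<..}" "q2 \<in> {0<..}"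
    using assms by auto
  have uv: "0 \<le> \<alpha>" "0 \<le> \<beta>" "\<alpha> + \<beta> = 1"
    using assms by auto
  \<comment> \<open>Concavity enters as convexity of the negated derivative, and
    \<open>segment_mean_minus\<close> restores the sign.\<close>
  have lower: "\<alpha> * G p1 q1 + \<beta> * G p2 q2 \<le> G p q"
    using segment_mean_convex[OF _ concave_log_sum' mem uv,
        of "\<lambda>s. - ?F s" "ln a" "ln b", OF DERIV_minus[OF DERIV_log_sum]]
    by (simp add: segment_mean_minus G_def ln_gini_mean assms p_def q_def)
  \<comment> \<open>Adding \<open>ln\<close> to the primitive adds \<open>1 / s\<close> to the
    averaged function, so each segment average gains the corresponding value of
    \<open>N\<close>.\<close>
  have "((\<lambda>s. ?F s + ln s) has_real_derivative ?f s + 1 / s) (at s)" if "s \<in> {0<..}" for s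
    using that by (auto intro!: DERIV_add DERIV_log_sum DERIV_ln_divide)
  then have upper: "G p q + N p q \<le> \<alpha> * (G p1 q1 + N p1 q1) + \<beta> * (G p2 q2 + N p2 q2)"
    using segment_mean_convex[OF _ convex_log_sum'_add_inverse mem uv,
        of "\<lambda>s. ?F s + ln s" "ln a" "ln b"]
    by (simp add: segment_mean_add G_def N_def inverse_log_mean ln_gini_mean assms p_def q_def)
  \<comment> \<open>Once the ratio is an exponential, both bounds compare exponents:
    \<open>lower\<close> makes this one nonnegative and \<open>upper\<close> bounds it
    above.\<close>
  have "gini_mean p q a b / (gini_mean p1 q1 a b powr \<alpha> * gini_mean p2 q2 a b powr \<beta>)
      = exp (G p q - (\<alpha> * G p1 q1 + \<beta> * G p2 q2))"
    using gini_mean_pos[OF assms(1,2)]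
    by (simp add: G_def powr_def exp_diff exp_add less_imp_neq[symmetric])
  moreover have "\<alpha> / log_mean p1 q1 + \<beta> / log_mean p2 q2 - 1 / log_mean p q
      = \<alpha> * N p1 q1 + \<beta> * N p2 q2 - N p q"
    by (simp add: N_def)
  ultimately show ?thesis
    using lower upper unfolding p_def[symmetric] q_def[symmetric]
    by (simp add: algebra_simps)
qed

end
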